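(* For every $n\ge1$, the $S$-set $\mathrm{Sym}(\mathbb{Z}_{2C}^n)$ is invariant under the action of $\Delta_n$: for every $\delta_r\in\Delta_n$ and every $X_C\in\mathrm{Sym}(\mathbb{Z}_{2C}^n)$, one has $(\delta_rX)_C\in\mathrm{Sym}(\mathbb{Z}_{2C}^n)$.
   Context: $\mathbb{Z}_2=\{+,-\}=\{1,-1\}$ and $\mathbb{Z}_2^n$ is the group of $\pm1$ sequences $X=(x_0,\dots,x_{n-1})$, indices modulo $n$. $C(x_0,\dots,x_{n-1})=(x_1,\dots,x_{n-1},x_0)$ and $X_C=\{C^i(X):0\le i<n\}$; $\mathbb{Z}_{2C}^n$ is the set of all such orbits. $RX=(x_{n-1},\dots,x_1,x_0)$ is the reversal. $X_C$ is symmetric if there exists $Y\in X_C$ with $RY=Y$; $\mathrm{Sym}(\mathbb{Z}_{2C}^n)$ is the set of all symmetric $X_C$. $\Delta_n=\{\delta_r:\gcd(r,n)=1\}$, where $(\delta_rX)_i=x_{ri\bmod n}$; it acts on orbits by $\delta_r(X_C)=(\delta_rX)_C$. *)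

theory Defs
  imports Main
begin

text \<open>Sequences $(x_0,\dots,x_{n-1})$ over $\{1,-1\}$ are lists of length \<open>n\<close>; the cyclic shift
  $C$ is \<^const>\<open>rotate1\<close>, so $C^i$ is \<^term>\<open>rotate i\<close>, and the reversal $R$ is \<^const>\<open>rev\<close>.\<close>

definition Z2n :: "nat \<Rightarrow> int list set" where
  "Z2n n = {X. length X = n \<and> set X \<subseteq> {1, -1}}"

definition orbitC :: "int list \<Rightarrow> int list set" where
  "orbitC X = {rotate i X | i. i < length X}"

definition Z2Cn :: "nat \<Rightarrow> int list set set" where
  "Z2Cn n = {orbitC X | X. X \<in> Z2n n}"

definition Sym :: "nat \<Rightarrow> int list set set" where
  "Sym n = {K \<in> Z2Cn n. \<exists>Y\<in>K. rev Y = Y}"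

definition delta :: "nat \<Rightarrow> int \<Rightarrow> int list \<Rightarrow> int list" where
  "delta n r X = map (\<lambda>i. X ! nat ((r * int i) mod int n)) [0..<n]"

definition Delta :: "nat \<Rightarrow> (int list \<Rightarrow> int list) set" where
  "Delta n = {delta n r | r. gcd r (int n) = 1}"

end

theory Submission
  imports Defs
begin

text \<open>Extend \<open>X\<close> to an \<open>n\<close>-periodic sequence $x$ on the integers. Its orbit is symmetric iff
  $x_k = x_{2i-1-k}$ for some $i$ and all $k$, that is, iff $x$ has a reflection with odd centre
  $c = 2i-1$. If $rs \equiv 1 \pmod n$, then $k \mapsto x_{rk}$ has the reflection with centre $sc$,
  and $s$ can be chosen odd: it is automatically so when $n$ is even, and otherwise $s$ can be
  replaced by $s + n$.\<close>

definition periodic :: "'a list \<Rightarrow> int \<Rightarrow> 'a" where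
  "periodic X k = X ! nat (k mod int (length X))"

lemma periodic_cong:
  assumes "k mod int (length X) = l mod int (length X)"
  shows "periodic X k = periodic X l"
  using assms by (simp add: periodic_def)

lemma periodic_of_nat: "i < length X \<Longrightarrow> periodic X (int i) = X ! i"
  by (simp add: periodic_def)

lemma nat_mod_less: "n > 0 \<Longrightarrow> nat (k mod int n) < n"
  by (simp add: nat_less_iff)

text \<open>Comparing at all integers, not only at positions below the length, lets later arguments
  substitute for \<open>k\<close> freely without range conditions.\<close>

lemma list_eq_iff_periodic:
  assumes "length X = length Y"
  shows "X = Y \<longleftrightarrow> (\<forall>k. periodic X k = periodic Y k)"
  using assms by (auto intro!: nth_equalityI) (metis periodic_of_nat)

lemma periodic_rotate:
  assumes "X \<noteq> []"
  shows "periodic (rotate i X) k = periodic X (k + int i)"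
proof -
  let ?n = "length X"
  have "periodic (rotate i X) k = X ! ((i + nat (k mod int ?n)) mod ?n)"
    using assms by (simp add: periodic_def nth_rotate nat_mod_less)
  also have "(i + nat (k mod int ?n)) mod ?n = nat ((k + int i) mod int ?n)"
    using assms by (simp add: nat_eq_iff2 zmod_int mod_simps add.commute)
  finally show ?thesis
    by (simp add: periodic_def)
qed

lemma periodic_rev:
  assumes "X \<noteq> []"
  shows "periodic (rev X) k = periodic X (- 1 - k)"
proof -
  let ?n = "int (length X)" and ?j = "k mod int (length X)"
  have n: "?n > 0"
    using assms by simp
  then have j: "0 \<le> ?j" "?j < ?n"
    by simp_all
  \<comment> \<open>Since \<open>?j\<close> lies in [0, n), \<open>- 1 - ?j\<close> lies in
    [-n, -1]; adding n gives the representative that \<open>rev_nth\<close> produces.\<close>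
  have "(- 1 - k) mod ?n = (- 1 - ?j + ?n) mod ?n"
    by (simp add: mod_simps)
  also have "\<dots> = ?n - 1 - ?j"
    using j by (subst mod_pos_pos_trivial) auto
  finally have "nat ((- 1 - k) mod ?n) = length X - Suc (nat ?j)"
    using j by linarith
  then show ?thesis
    using assms by (simp add: periodic_def rev_nth nat_mod_less)
qed

lemma length_delta [simp]: "length (delta n r X) = n"
  by (simp add: delta_def)

text \<open>Reducing \<open>k\<close> modulo n before multiplying by \<open>r\<close> does not
  change the residue of \<open>r * k\<close>, so the action becomes a substitution on the
  integers.\<close>

lemma periodic_delta:
  assumes "length X = n" "n > 0"
  shows "periodic (delta n r X) k = periodic X (r * k)"
  using assms by (simp add: periodic_def delta_def nat_mod_less mod_simps)

lemma delta_in_Z2n: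
  assumes "X \<in> Z2n n" "n > 0"
  shows "delta n r X \<in> Z2n n"
proof -
  have "set (delta n r X) \<subseteq> set X"
    using assms by (auto simp: delta_def Z2n_def nat_mod_less)
  then show ?thesis
    using assms by (auto simp: Z2n_def)
qed

text \<open>In terms of the extension, a palindromic \<open>rotate i X\<close> means invariance
  under -1-k+i \<leftrightarrow> k+i; these two indices sum to 2i-1, the centre. Any integer
  \<open>i\<close> may serve, as only its residue modulo n matters.\<close>

lemma orbitC_in_Sym_iff:
  assumes "X \<in> Z2n n" "n > 0"
  shows "orbitC X \<in> Sym n \<longleftrightarrow> (\<exists>i. \<forall>k. periodic X k = periodic X (2 * i - 1 - k))"
    (is "_ \<longleftrightarrow> ?R")
proof -
  have len: "length X = n" and ne: "X \<noteq> []"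
    using assms by (auto simp: Z2n_def)
  have palindrome: "rev (rotate i X) = rotate i X \<longleftrightarrow>
      (\<forall>k. periodic X k = periodic X (2 * int i - 1 - k))" for i
  proof -
    have "rev (rotate i X) = rotate i X \<longleftrightarrow>
        (\<forall>k. periodic X (- 1 - k + int i) = periodic X (k + int i))"
      using ne by (simp add: list_eq_iff_periodic periodic_rev periodic_rotate)
    also have "\<dots> \<longleftrightarrow> (\<forall>k. periodic X k = periodic X (2 * int i - 1 - k))"
    proof (intro iffI allI)
      fix k
      assume "\<forall>k. periodic X (- 1 - k + int i) = periodic X (k + int i)"
      from this[rule_format, of "k - int i"]
      show "periodic X k = periodic X (2 * int i - 1 - k)"
        by (simp add: algebra_simps)
    next
      fix k
      assume "\<forall>k. periodic X k = periodic X (2 * int i - 1 - k)"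
      from this[rule_format, of "k + int i"]
      show "periodic X (- 1 - k + int i) = periodic X (k + int i)"
        by (simp add: algebra_simps)
    qed
    finally show ?thesis .
  qed
  have "orbitC X \<in> Sym n \<longleftrightarrow> (\<exists>i<n. rev (rotate i X) = rotate i X)"
    using assms(1) len by (auto simp: Sym_def Z2Cn_def orbitC_def)
  also have "\<dots> \<longleftrightarrow> ?R"
  proof
    assume "\<exists>i<n. rev (rotate i X) = rotate i X"
    then show ?R
      using palindrome by blast
  next
    assume ?R
    then obtain i where i: "\<And>k. periodic X k = periodic X (2 * i - 1 - k)"
      by blast
    \<comment> \<open>The orbit only uses rotations by less than n. Reducing \<open>i\<close> modulo
      n changes 2i-1 by a multiple of n, which the periodic extension does not see.\<close>
    let ?j = "nat (i mod int n)"
    have "(2 * i - 1 - k) mod int n = (2 * int ?j - 1 - k) mod int n" for k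
      using assms(2) by (intro mod_diff_cong mod_mult_cong) simp_all
    then have "periodic X k = periodic X (2 * int ?j - 1 - k)" for k
      using i periodic_cong len by metis
    then have "rev (rotate ?j X) = rotate ?j X"
      unfolding palindrome by blast
    then show "\<exists>i<n. rev (rotate i X) = rotate i X"
      using nat_mod_less[OF assms(2)] by blast
  qed
  finally show ?thesis .
qed

lemma odd_inverse_mod:
  fixes r m :: int
  assumes "gcd r m = 1"
  obtains s where "odd s" "(r * s) mod m = 1 mod m"
proof -
  obtain s t where st: "s * r + t * m = 1"
    using bezout_int[of r m] assms by auto
  then have *: "r * s = 1 + m * (- t)" "r * (s + m) = 1 + m * (r - t)"
    by (simp_all add: algebra_simps)
  have "(r * s) mod m = 1 mod m" "(r * (s + m)) mod m = 1 mod m"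
    by (simp_all only: * mod_mult_self2)
  \<comment> \<open>If both were even, \<open>m\<close> would be even too, and so would
    \<open>s * r + t * m\<close>, which is 1.\<close>
  moreover have "odd s \<or> odd (s + m)"
    using st by (metis even_add even_mult_iff odd_one)
  ultimately show thesis
    using that by blast
qed

theorem theorem10:
  fixes n :: nat
  assumes "n \<ge> 1"
  shows "\<forall>d\<in>Delta n. \<forall>X\<in>Z2n n. orbitC X \<in> Sym n \<longrightarrow> orbitC (d X) \<in> Sym n"
proof (intro ballI impI)
  fix d X
  assume d: "d \<in> Delta n" and X: "X \<in> Z2n n" and sym: "orbitC X \<in> Sym n"
  have n: "n > 0" and len: "length X = n"
    using assms X by (auto simp: Z2n_def)
  obtain r where r: "d = delta n r" "gcd r (int n) = 1"
    using d by (auto simp: Delta_def)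
  obtain i where i: "\<And>k. periodic X k = periodic X (2 * i - 1 - k)"
    using sym orbitC_in_Sym_iff[OF X n] by blast
  obtain s where s: "odd s" "(r * s) mod int n = 1 mod int n"
    using odd_inverse_mod[OF r(2)] .
  \<comment> \<open>The new centre is a product of odd numbers, hence of the form 2j-1 that the
    symmetry criterion asks for.\<close>
  have "even (s * (2 * i - 1) + 1)"
    using s(1) by simp
  then obtain j where "s * (2 * i - 1) + 1 = 2 * j" ..
  then have j: "2 * j - 1 = s * (2 * i - 1)"
    by simp
  have "periodic (d X) k = periodic (d X) (2 * j - 1 - k)" for k
  proof -
    \<comment> \<open>Multiplication by \<open>r\<close> undoes the factor \<open>s\<close> in the
      centre, so reflecting \<open>k\<close> about 2j-1 amounts modulo n to reflecting
      \<open>r * k\<close> about 2i-1.\<close>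
    have "(r * s * (2 * i - 1) - r * k) mod int n = (1 * (2 * i - 1) - r * k) mod int n"
      using s(2) by (intro mod_diff_cong mod_mult_cong) simp_all
    then have "periodic X (r * (2 * j - 1 - k)) = periodic X (2 * i - 1 - r * k)"
      unfolding j by (intro periodic_cong) (simp add: len right_diff_distrib mult.assoc)
    then show ?thesis
      using i[of "r * k"] by (simp add: r(1) periodic_delta[OF len n])
  qed
  then show "orbitC (d X) \<in> Sym n"
    using orbitC_in_Sym_iff[OF delta_in_Z2n[OF X n] n] r(1) by blast
qed

end
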